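(* Let $S=\{(x_j,y_j)\}_{j=1}^n\subseteq\mathbb{R}^d\times\{-1,1\}$ be a dataset, $C>0$, and $K:\mathbb{R}^d\times\mathbb{R}^d\to\mathbb{R}$ a positive definite kernel. Let $\mathcal{A}_{\mathrm{SVM}}$ be a deterministic algorithm for the constrained SVM problem satisfying: for all $I,J\subseteq[n]$, $\operatorname{supp}(\mathcal{A}_{\mathrm{SVM}}(I))\subseteq J\subseteq I$ implies $\mathcal{A}_{\mathrm{SVM}}(I)=\mathcal{A}_{\mathrm{SVM}}(J)$. Then the algorithm EnumSV, run on $(S,C,K)$, solves the enumeration problem for SVMs: it enumerates all distinct models $\alpha$ in $\mathcal{M}_{\mathrm{all}}=\{\mathcal{A}_{\mathrm{SVM}}(I)\mid I\subseteq[n]\}$, without duplicates, in descending (i.e. non-increasing) order of their objective function values $f(\alpha)$.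
   Context: Notation: $[n]=\{1,\dots,n\}$. For $\alpha\in\mathbb{R}^n$, $\operatorname{supp}(\alpha)=\{j\in[n]\mid\alpha_j\neq0\}$. The objective function is $$f(\alpha)=\sum_{j\in[n]}\alpha_j-\frac12\sum_{i,j\in[n]}\alpha_i\alpha_jy_iy_jK(x_i,x_j).$$ The feasible set (model space) $\mathcal{F}$ is the set of $\alpha\in\mathbb{R}^n$ with $\sum_{j\in[n]}\alpha_jy_j=0$ and $\alpha_j\in[0,C]$ for all $j\in[n]$. Elements of $\mathcal{F}$ are called models. For $I\subseteq[n]$, $\mathcal{F}(I)=\{\alpha\in\mathcal{F}\mid\operatorname{supp}(\alpha)\subseteq I\}$, and $\mathrm{SVM}(I)=\{\alpha\in\mathcal{F}(I)\mid f(\alpha)=\max_{\beta\in\mathcal{F}(I)}f(\beta)\}$ is the set of globally optimal solutions of the constrained SVM problem for $I$. An algorithm for the constrained SVM problem is a deterministic map $\mathcal{A}_{\mathrm{SVM}}:2^{[n]}\to\mathcal{F}$ (with $S,C,K$ fixed) such that $\mathcal{A}_{\mathrm{SVM}}(I)\in\mathrm{SVM}(I)$ for every $I\subseteq[n]$. Algorithm EnumSV. It maintains a priority queue $H$ of triples $(\alpha,I,B)$ with $\alpha\in\mathcal{F}$ and $I,B\subseteq[n]$; extraction removes a triple with maximum key $f(\alpha)$ (ties broken arbitrarily). It also maintains a collection $\mathcal{M}$ of models, ordered by time of insertion. 1. Set $H\leftarrow\emptyset$, insert $(\mathcal{A}_{\mathrm{SVM}}([n]),[n],\emptyset)$ into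 $H$, and set $\mathcal{M}\leftarrow\emptyset$. 2. While $H\neq\emptyset$: extract a triple $(\alpha,I,B)$ with maximum key from $H$; if $\alpha\notin\mathcal{M}$, insert $\alpha$ into $\mathcal{M}$. Then, for each $j\in\operatorname{supp}(\alpha)\setminus B$ in turn (in any order): set $I'\leftarrow I\setminus\{j\}$, $\alpha'\leftarrow\mathcal{A}_{\mathrm{SVM}}(I')$, insert $(\alpha',I',B)$ into $H$ with the current $B$, and then set $B\leftarrow B\cup\{j\}$. 3. When $H=\emptyset$, return $\mathcal{M}$. The models enumerated by EnumSV are the elements of $\mathcal{M}$, in order of insertion. *)

theory Defs
  imports "HOL-Analysis.Analysis" "HOL-Library.Multiset"
begin

text \<open>
  The index set \<open>[n]\<close> is the finite type \<open>'n\<close>, so \<open>\<real>\<^sup>n\<close> is \<open>real ^ 'n\<close>, subsets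
  of \<open>[n]\<close> are arbitrary values of type \<open>'n set\<close>, and \<open>\<real>\<^sup>d\<close> is \<open>real ^ 'd\<close>. The dataset is the
  indexed family of pairs \<open>(x j, y j)\<close>, in which repeated pairs are allowed.
\<close>

text \<open>
  As usual for kernels, positive definiteness means that all Gram matrices are symmetric and
  positive semidefinite. The points \<open>z i\<close> need not be distinct.
\<close>

definition positive_definite_kernel :: "('a \<Rightarrow> 'a \<Rightarrow> real) \<Rightarrow> bool" where
  "positive_definite_kernel K \<longleftrightarrow>
     (\<forall>u v. K u v = K v u) \<and>
     (\<forall>(m::nat) (z :: nat \<Rightarrow> 'a) (c :: nat \<Rightarrow> real).
        (\<Sum>i<m. \<Sum>j<m. c i * c j * K (z i) (z j)) \<ge> 0)"

definition supp :: "real ^ 'n \<Rightarrow> 'n set" where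
  "supp \<alpha> = {j. \<alpha> $ j \<noteq> 0}"

definition svm_objective ::
  "('n::finite \<Rightarrow> 'a) \<Rightarrow> ('n \<Rightarrow> real) \<Rightarrow> ('a \<Rightarrow> 'a \<Rightarrow> real) \<Rightarrow> real ^ 'n \<Rightarrow> real" where
  "svm_objective x y K \<alpha> =
     (\<Sum>j\<in>UNIV. \<alpha> $ j)
     - 1 / 2 * (\<Sum>i\<in>UNIV. \<Sum>j\<in>UNIV. \<alpha> $ i * \<alpha> $ j * y i * y j * K (x i) (x j))"

definition model_space :: "('n::finite \<Rightarrow> real) \<Rightarrow> real \<Rightarrow> (real ^ 'n) set" where
  "model_space y C = {\<alpha>. (\<Sum>j\<in>UNIV. \<alpha> $ j * y j) = 0 \<and> (\<forall>j. \<alpha> $ j \<in> {0..C})}"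

definition model_space_on :: "('n::finite \<Rightarrow> real) \<Rightarrow> real \<Rightarrow> 'n set \<Rightarrow> (real ^ 'n) set" where
  "model_space_on y C I = {\<alpha> \<in> model_space y C. supp \<alpha> \<subseteq> I}"

definition svm_solutions ::
  "('n::finite \<Rightarrow> 'a) \<Rightarrow> ('n \<Rightarrow> real) \<Rightarrow> real \<Rightarrow> ('a \<Rightarrow> 'a \<Rightarrow> real) \<Rightarrow> 'n set \<Rightarrow> (real ^ 'n) set" where
  "svm_solutions x y C K I =
     {\<alpha> \<in> model_space_on y C I.
        \<forall>\<beta> \<in> model_space_on y C I. svm_objective x y K \<beta> \<le> svm_objective x y K \<alpha>}"

definition svm_algorithm ::
  "('n::finite \<Rightarrow> 'a) \<Rightarrow> ('n \<Rightarrow> real) \<Rightarrow> real \<Rightarrow> ('a \<Rightarrow> 'a \<Rightarrow> real) \<Rightarrow> ('n set \<Rightarrow> real ^ 'n) \<Rightarrow> bool" where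
  "svm_algorithm x y C K A \<longleftrightarrow> (\<forall>I. A I \<in> svm_solutions x y C K I)"

type_synonym 'n queue_entry = "(real ^ 'n) \<times> 'n set \<times> 'n set"

text \<open>
  A state \<open>(H, M)\<close> consists of the priority queue, a multiset because equal triples are
  not identified, and the models found so far, oldest first.
\<close>

type_synonym 'n enum_state = "'n queue_entry multiset \<times> (real ^ 'n) list"

text \<open>The inner for-loop on a fixed \<open>I\<close>; the list holds the remaining indices in loop order.\<close>

fun expand ::
  "('n set \<Rightarrow> real ^ 'n) \<Rightarrow> 'n set \<Rightarrow> 'n list \<Rightarrow> 'n set \<Rightarrow>
   'n queue_entry multiset \<Rightarrow> 'n queue_entry multiset" where
  "expand A I [] B H = H"
| "expand A I (j # js) B H =
     expand A I js (insert j B) (add_mset (A (I - {j}), I - {j}, B) H)"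

definition enum_init :: "('n set \<Rightarrow> real ^ 'n) \<Rightarrow> 'n enum_state" where
  "enum_init A = ({#(A UNIV, UNIV, {})#}, [])"

text \<open>
  One iteration of the while-loop with key function \<open>f\<close>. The relation is nondeterministic:
  any triple of maximum key may be extracted, and \<open>js\<close> may be any ordering of
  \<open>supp \<alpha> - B\<close>, with \<open>B\<close> taken at entry to the for-loop.
\<close>

inductive enum_step ::
  "(real ^ 'n \<Rightarrow> real) \<Rightarrow> ('n set \<Rightarrow> real ^ 'n) \<Rightarrow> 'n enum_state \<Rightarrow> 'n enum_state \<Rightarrow> bool"
  for f A where
  "enum_step f A (H, M)
     (expand A I js B (H - {#(\<alpha>, I, B)#}), if \<alpha> \<in> set M then M else M @ [\<alpha>])"
  if "(\<alpha>, I, B) \<in># H"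
    and "\<forall>(\<beta>, I', B') \<in># H. f \<beta> \<le> f \<alpha>"
    and "distinct js" and "set js = supp \<alpha> - B"

end

theory Submission
  imports Defs
begin

text \<open>
  A queue entry \<open>(A I, I, B)\<close> stands for the interval of index sets \<open>J\<close> with
  \<open>B \<subseteq> J \<subseteq> I\<close>. If \<open>supp (A I) \<subseteq> J\<close> then \<open>A J = A I\<close> is the model that is output;
  otherwise \<open>J\<close> lies in the interval of the child for the first loop index outside \<open>J\<close>. So no
  model is lost. The child for the \<open>k\<close>-th index has an interval of size at most \<open>2 ^ (m - k)\<close>,
  where \<open>m = card (I - B)\<close>, so the total size of the intervals in the queue decreases in every
  iteration. Finally, shrinking \<open>I\<close> cannot increase the optimum, so the keys inserted never exceed
  the key just extracted, and the output is sorted.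
\<close>

lemma mem_expand_mono: "z \<in># H \<Longrightarrow> z \<in># expand A I js B H"
  by (induction js arbitrary: B H) auto

lemma mem_expandD:
  "z \<in># expand A I js B H \<Longrightarrow> z \<in># H \<or> (\<exists>j\<in>set js. \<exists>B'. z = (A (I - {j}), I - {j}, B'))"
proof (induction js arbitrary: B H)
  case (Cons j js)
  then show ?case
    using Cons.IH[of "insert j B" "add_mset (A (I - {j}), I - {j}, B) H"] by auto
qed simp

text \<open>Until the loop reaches its first index outside \<open>J\<close>, every index added to
  \<open>B\<close> lies in \<open>J\<close>, so the child created there still has its lower bound
  inside \<open>J\<close>.\<close>

lemma expand_covers:
  assumes "B \<subseteq> J" "J \<subseteq> I" "j \<in> set js" "j \<notin> J"
  shows "\<exists>\<alpha> I' B'. (\<alpha>, I', B') \<in># expand A I js B H \<and> B' \<subseteq> J \<and> J \<subseteq> I'"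
  using assms
proof (induction js arbitrary: B H)
  case Nil
  then show ?case by simp
next
  case (Cons i js)
  show ?case
  proof (cases "i \<in> J")
    case True
    then have "insert i B \<subseteq> J" "j \<in> set js"
      using Cons.prems by auto
    then show ?thesis
      using Cons.IH Cons.prems by simp
  next
    case False
    have "(A (I - {i}), I - {i}, B) \<in># expand A I (i # js) B H"
      by (simp add: mem_expand_mono)
    moreover have "J \<subseteq> I - {i}"
      using False Cons.prems by auto
    ultimately show ?thesis
      using Cons.prems by blast
  qed
qed

text \<open>For \<open>B \<subseteq> I\<close> the summand counts the sets \<open>J\<close> with
  \<open>B \<subseteq> J \<subseteq> I\<close>; repeated entries count repeatedly.\<close>

definition queue_weight :: "'n::finite queue_entry multiset \<Rightarrow> nat" where
  "queue_weight H = (\<Sum>(\<alpha>, I, B) \<in># H. 2 ^ card (I - B))"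

lemma queue_weight_add_mset [simp]:
  "queue_weight (add_mset (\<alpha>, I, B) H) = 2 ^ card (I - B) + queue_weight H"
  by (simp add: queue_weight_def)

text \<open>With \<open>m = card (I - B)\<close> the children weigh \<open>2 ^ (m - 1)\<close>,
  \<open>2 ^ (m - 2)\<close> and so on, and such a sum stays below \<open>2 ^ m\<close>.\<close>

lemma queue_weight_expand_less:
  fixes A :: "'n::finite set \<Rightarrow> real ^ 'n"
  assumes "distinct js" "set js \<subseteq> I - B"
  shows "queue_weight (expand A I js B H) < queue_weight H + 2 ^ card (I - B)"
  using assms
proof (induction js arbitrary: B H)
  case Nil
  then show ?case by simp
next
  case (Cons j js)
  let ?c = "card (I - insert j B)"
  have "I - B = insert j (I - insert j B)"
    using Cons.prems by auto
  then have "card (I - B) = Suc ?c"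
    by (metis Diff_iff card_insert_disjoint finite insertI1)
  \<comment> \<open>One half pays for the child of \<open>j\<close>, the other bounds the rest of
    the loop.\<close>
  then have split: "(2::nat) ^ card (I - B) = 2 ^ ?c + 2 ^ ?c"
    by simp
  have child: "I - {j} - B = I - insert j B"
    by auto
  let ?H = "add_mset (A (I - {j}), I - {j}, B) H"
  have "queue_weight (expand A I js (insert j B) ?H) < queue_weight ?H + 2 ^ ?c"
    using Cons.prems by (intro Cons.IH) auto
  also have "\<dots> = queue_weight H + 2 ^ card (I - B)"
    unfolding queue_weight_add_mset child split by simp
  finally show ?case
    by simp
qed

text \<open>A run can thus get stuck only with an empty queue: a nonempty finite queue has an entry
  of maximum key, and a finite support can be listed.\<close>

lemma enum_step_exists:
  fixes H :: "'n::finite queue_entry multiset"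
  assumes "H \<noteq> {#}"
  shows "\<exists>s'. enum_step f A (H, M) s'"
proof -
  let ?keys = "(\<lambda>z. f (fst z)) ` set_mset H"
  have "Max ?keys \<in> ?keys"
    using assms by (intro Max_in) auto
  then obtain \<alpha> I B where "(\<alpha>, I, B) \<in># H" "f \<alpha> = Max ?keys"
    by auto
  moreover from this have "\<forall>(\<beta>, I', B') \<in># H. f \<beta> \<le> f \<alpha>"
    by (force intro!: Max_ge)
  moreover obtain js where "distinct js" "set js = supp \<alpha> - B"
    using finite_distinct_list[of "supp \<alpha> - B"] by auto
  ultimately show ?thesis
    using enum_step.intros by blast
qed

text \<open>Each assumption serves one claim: \<open>supp_subset\<close> termination,
  \<open>key_mono\<close> the order of the output, \<open>stable\<close> its completeness.\<close>

locale stable_oracle =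
  fixes f :: "real ^ 'n::finite \<Rightarrow> real" and A :: "'n set \<Rightarrow> real ^ 'n"
  assumes supp_subset: "supp (A I) \<subseteq> I"
    and key_mono: "J \<subseteq> I \<Longrightarrow> f (A J) \<le> f (A I)"
    and stable: "\<lbrakk>supp (A I) \<subseteq> J; J \<subseteq> I\<rbrakk> \<Longrightarrow> A I = A J"
begin

definition entries_ok :: "'n queue_entry multiset \<Rightarrow> bool" where
  "entries_ok H \<longleftrightarrow> (\<forall>(\<alpha>, I, B) \<in># H. \<alpha> = A I)"

text \<open>The bound of queued keys by output keys keeps the list sorted when a model is appended.
  The last clause becomes completeness once the queue is empty.\<close>

definition enum_inv :: "'n enum_state \<Rightarrow> bool" where
  "enum_inv = (\<lambda>(H, M).
     entries_ok H \<and>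
     set M \<subseteq> range A \<and> distinct M \<and> sorted_wrt (\<lambda>\<alpha> \<beta>. f \<alpha> \<ge> f \<beta>) M \<and>
     (\<forall>\<beta> \<in> set M. \<forall>(\<alpha>, I, B) \<in># H. f \<alpha> \<le> f \<beta>) \<and>
     (\<forall>J. A J \<in> set M \<or> (\<exists>\<alpha> I B. (\<alpha>, I, B) \<in># H \<and> B \<subseteq> J \<and> J \<subseteq> I)))"

lemma enum_inv_init: "enum_inv (enum_init A)"
  by (auto simp: enum_inv_def entries_ok_def enum_init_def)

lemma enum_inv_step:
  assumes "enum_step f A s s'" "enum_inv s"
  shows "enum_inv s'"
  using assms
proof cases
  case (1 \<alpha> I B H js M)
  let ?M = "if \<alpha> \<in> set M then M else M @ [\<alpha>]"
  let ?H = "expand A I js B (H - {#(\<alpha>, I, B)#})"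
  from assms(2) 1(1) have inv:
    "\<And>\<beta> I' B'. (\<beta>, I', B') \<in># H \<Longrightarrow> \<beta> = A I'"
    "set M \<subseteq> range A" "distinct M" "sorted_wrt (\<lambda>\<alpha> \<beta>. f \<alpha> \<ge> f \<beta>) M"
    "\<And>\<gamma> \<beta> I' B'. \<lbrakk>\<gamma> \<in> set M; (\<beta>, I', B') \<in># H\<rbrakk> \<Longrightarrow> f \<beta> \<le> f \<gamma>"
    "\<And>J. A J \<in> set M \<or> (\<exists>\<alpha> I B. (\<alpha>, I, B) \<in># H \<and> B \<subseteq> J \<and> J \<subseteq> I)"
    unfolding enum_inv_def entries_ok_def by fastforce+
  have \<alpha>: "\<alpha> = A I"
    using inv(1) 1(3) by blast
  \<comment> \<open>The key \<open>f \<alpha>\<close> separates the new output from the new queue;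
    for the children this is \<open>key_mono\<close>.\<close>
  have le_key: "f \<gamma> \<ge> f \<alpha>" if "\<gamma> \<in> set ?M" for \<gamma>
    using that inv(5)[OF _ 1(3)] by (auto split: if_splits)
  have new: "\<beta> = A I' \<and> f \<beta> \<le> f \<alpha>" if "(\<beta>, I', B') \<in># ?H" for \<beta> I' B'
    using mem_expandD[OF that]
  proof
    assume "(\<beta>, I', B') \<in># H - {#(\<alpha>, I, B)#}"
    then have "(\<beta>, I', B') \<in># H"
      by (rule in_diffD)
    then show ?thesis
      using inv(1) \<open>\<forall>(\<beta>, I', B') \<in># H. f \<beta> \<le> f \<alpha>\<close> by auto
  next
    assume "\<exists>j\<in>set js. \<exists>B''. (\<beta>, I', B') = (A (I - {j}), I - {j}, B'')"
    then show ?thesis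
      using key_mono[of _ I] \<alpha> by auto
  qed
  have covered: "A J \<in> set ?M \<or> (\<exists>\<beta> I' B'. (\<beta>, I', B') \<in># ?H \<and> B' \<subseteq> J \<and> J \<subseteq> I')" for J
  proof (cases "A J \<in> set ?M")
    case False
    then obtain \<beta> I' B' where J: "(\<beta>, I', B') \<in># H" "B' \<subseteq> J" "J \<subseteq> I'"
      using inv(6)[of J] by (auto split: if_splits)
    show ?thesis
    proof (cases "(\<beta>, I', B') = (\<alpha>, I, B)")
      case True
      \<comment> \<open>By \<open>stable\<close>, a set \<open>J\<close> whose model is still
        missing must omit an index of \<open>supp (A I)\<close>. As \<open>B \<subseteq> J\<close>,
        that index is outside \<open>B\<close>, so the loop visits it.\<close>
      have "A I \<noteq> A J"
        using False \<alpha> by (auto split: if_splits)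
      then obtain j where "j \<in> supp (A I)" "j \<notin> J"
        using stable[of I J] J True by auto
      then have "j \<in> set js"
        using 1(6) \<alpha> J True by auto
      then show ?thesis
        using expand_covers[of B J I j js] J True \<open>j \<notin> J\<close> by blast
    next
      case False
      then have "(\<beta>, I', B') \<in># H - {#(\<alpha>, I, B)#}"
        using J(1) False by (auto simp: in_diff_count)
      then show ?thesis
        using mem_expand_mono J by blast
    qed
  qed simp
  have "set ?M \<subseteq> range A" "distinct ?M"
    using inv(2,3) \<alpha> by auto
  moreover have "sorted_wrt (\<lambda>\<alpha> \<beta>. f \<alpha> \<ge> f \<beta>) ?M"
    using inv(4) inv(5)[OF _ 1(3)] by (auto simp: sorted_wrt_append)
  moreover have "\<forall>\<gamma> \<in> set ?M. \<forall>(\<beta>, I', B') \<in># ?H. f \<beta> \<le> f \<gamma>"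
    using new le_key order_trans by blast
  moreover have "entries_ok ?H"
    using new unfolding entries_ok_def by blast
  ultimately show ?thesis
    using covered unfolding 1(2) enum_inv_def by blast
qed

lemma enum_inv_reachable:
  "(enum_step f A)\<^sup>*\<^sup>* (enum_init A) s \<Longrightarrow> enum_inv s"
  by (induction rule: rtranclp_induct) (auto intro: enum_inv_init enum_inv_step)

text \<open>The invariant gives \<open>\<alpha> = A I\<close>, which places all loop indices in
  \<open>I - B\<close>; the children then weigh less than the extracted entry.\<close>

lemma queue_weight_step_less:
  assumes "enum_step f A s s'" "enum_inv s"
  shows "queue_weight (fst s') < queue_weight (fst s)"
  using assms
proof cases
  case (1 \<alpha> I B H js M)
  have "\<alpha> = A I"
    using assms(2) 1 unfolding enum_inv_def entries_ok_def by fastforce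
  then have "set js \<subseteq> I - B"
    using 1 supp_subset by auto
  then have "queue_weight (fst s') < queue_weight (H - {#(\<alpha>, I, B)#}) + 2 ^ card (I - B)"
    using queue_weight_expand_less[OF 1(5)] 1(2) by simp
  also have "\<dots> = queue_weight (add_mset (\<alpha>, I, B) (H - {#(\<alpha>, I, B)#}))"
    by simp
  also have "\<dots> = queue_weight (fst s)"
    using 1 by simp
  finally show ?thesis .
qed

theorem enum_terminates:
  "\<nexists>s. s 0 = enum_init A \<and> (\<forall>k::nat. enum_step f A (s k) (s (Suc k)))"
proof
  assume "\<exists>s. s 0 = enum_init A \<and> (\<forall>k::nat. enum_step f A (s k) (s (Suc k)))"
  then obtain s where s: "s 0 = enum_init A" "\<And>k::nat. enum_step f A (s k) (s (Suc k))"
    by blast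
  have "enum_inv (s k)" for k
    by (induction k) (use s enum_inv_init in simp, use s(2) enum_inv_step in blast)
  then have less: "queue_weight (fst (s (Suc k))) < queue_weight (fst (s k))" for k
    using s(2) queue_weight_step_less by blast
  have "queue_weight (fst (s k)) + k \<le> queue_weight (fst (s 0))" for k
  proof (induction k)
    case (Suc k)
    then show ?case
      using less[of k] by linarith
  qed simp
  \<comment> \<open>No run has more steps than the initial weight.\<close>
  from this[of "Suc (queue_weight (fst (s 0)))"] show False
    by linarith
qed

theorem enum_final_state:
  assumes "(enum_step f A)\<^sup>*\<^sup>* (enum_init A) (H, M)" "\<nexists>s'. enum_step f A (H, M) s'"
  shows "H = {#}" "set M = range A" "distinct M" "sorted_wrt (\<lambda>\<alpha> \<beta>. f \<alpha> \<ge> f \<beta>) M"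
proof -
  show "H = {#}"
    using assms(2) enum_step_exists by blast
  then show "set M = range A" "distinct M" "sorted_wrt (\<lambda>\<alpha> \<beta>. f \<alpha> \<ge> f \<beta>) M"
    using enum_inv_reachable[OF assms(1)] unfolding enum_inv_def by auto
qed

end

lemma svm_algorithm_supp:
  assumes "svm_algorithm x y C K A"
  shows "supp (A I) \<subseteq> I"
  using assms by (auto simp: svm_algorithm_def svm_solutions_def model_space_on_def)

text \<open>The optimum for \<open>J\<close> is still feasible for the larger set
  \<open>I\<close>.\<close>

lemma svm_algorithm_objective_mono:
  assumes "svm_algorithm x y C K A" "J \<subseteq> I"
  shows "svm_objective x y K (A J) \<le> svm_objective x y K (A I)"
proof -
  have "A J \<in> model_space_on y C J"
    using assms(1) by (simp add: svm_algorithm_def svm_solutions_def)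
  then have "A J \<in> model_space_on y C I"
    using assms(2) by (auto simp: model_space_on_def)
  then show ?thesis
    using assms(1) by (simp add: svm_algorithm_def svm_solutions_def)
qed

theorem theorem1:
  fixes x :: "'n::finite \<Rightarrow> real ^ 'd"
    and y :: "'n \<Rightarrow> real"
    and C :: real
    and K :: "real ^ 'd \<Rightarrow> real ^ 'd \<Rightarrow> real"
    and A :: "'n set \<Rightarrow> real ^ 'n"
  assumes "\<forall>j. y j \<in> {-1, 1}"
    and "C > 0"
    and "positive_definite_kernel K"
    and "svm_algorithm x y C K A"
    and "\<forall>I J. supp (A I) \<subseteq> J \<and> J \<subseteq> I \<longrightarrow> A I = A J"
  defines "f \<equiv> svm_objective x y K"
  shows "(\<nexists>s. s 0 = enum_init A \<and> (\<forall>k::nat. enum_step f A (s k) (s (Suc k)))) \<and>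
         (\<forall>H M. (enum_step f A)\<^sup>*\<^sup>* (enum_init A) (H, M) \<and> (\<nexists>s'. enum_step f A (H, M) s') \<longrightarrow>
            H = {#} \<and>
            set M = {A I | I. I \<subseteq> UNIV} \<and>
            distinct M \<and>
            sorted_wrt (\<lambda>\<alpha> \<beta>. f \<alpha> \<ge> f \<beta>) M)"
proof -
  interpret stable_oracle f A
  proof
    show "supp (A I) \<subseteq> I" for I
      using assms(4) by (rule svm_algorithm_supp)
    show "f (A J) \<le> f (A I)" if "J \<subseteq> I" for I J
      unfolding f_def using assms(4) that by (rule svm_algorithm_objective_mono)
    show "A I = A J" if "supp (A I) \<subseteq> J" "J \<subseteq> I" for I J
      using assms(5) that by blast
  qed
  have all_models: "{A I | I. I \<subseteq> UNIV} = range A"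
    by auto
  show ?thesis
    unfolding all_models
    by (intro conjI allI impI; (elim conjE)?)
      (rule enum_terminates enum_final_state; assumption)+
qed

end
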